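(* Let $n,k,r$ be positive integers with $r\geq 2$ and $n\geq rk$. The circular chromatic number of the $r$-interlacing graph $\mathrm{IG}_{n,k}^{(r)}$ is equal to $n/k$.
   Context: Write $[n]=\{1,\ldots,n\}$ and view its elements as placed in clockwise order on a circle; a $k$-subset of $[n]$ is called a $k$-polygon. A $k$-polygon $P$ is $r$-stable if for every pair of distinct points $a,b\in P$ there are at least $r-1$ elements of $[n]$ between $a$ and $b$ on the circle (in each of the two arcs), i.e. the cyclic distance between any two points of $P$ is at least $r$. Two $k$-polygons $P=\{p_1<\cdots<p_k\}$ and $Q=\{q_1<\cdots<q_k\}$ interlace if either $p_1<q_1<p_2<q_2<\cdots<p_k<q_k$ or $q_1<p_1<q_2<p_2<\cdots<q_k<p_k$. The graph $\mathrm{IG}_{n,k}^{(r)}$ has as vertices the $r$-stable $k$-polygons on $[n]$, two being adjacent iff they interlace. A circular coloring of size $a/b$ of a graph $G=(V,E)$ is a map $\chi:V\to\mathbb{Z}/a\mathbb{Z}$ such that $\chi(v_1)-\chi(v_2)\in\{\overline{b},\overline{b+1},\ldots,\overline{-b}\}$ whenever $v_1v_2\in E$; the circular chromatic number $\chi_c(G)$ is the minimum rational $a/b$ for which such a coloring exists. *)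

theory Defs
  imports Complex_Main "Graph_Theory.Pair_Digraph"
begin

definition polygons :: "nat \<Rightarrow> nat \<Rightarrow> nat set set" where
  "polygons n k = {P. P \<subseteq> {1..n} \<and> card P = k}"

text \<open>The elements of \<open>[n]\<close> met strictly between \<open>a\<close> and \<open>b\<close> when going clockwise from
  \<open>a\<close> to \<open>b\<close>. The other of the two arcs determined by \<open>a\<close> and \<open>b\<close> is \<open>open_arc n b a\<close>.\<close>

definition open_arc :: "nat \<Rightarrow> nat \<Rightarrow> nat \<Rightarrow> nat set" where
  "open_arc n a b = (if a < b then {a<..<b} else {a<..n} \<union> {1..<b})"

definition stable :: "nat \<Rightarrow> nat \<Rightarrow> nat set \<Rightarrow> bool" where
  "stable n r P \<longleftrightarrow> (\<forall>a\<in>P. \<forall>b\<in>P. a \<noteq> b \<longrightarrow> r - 1 \<le> card (open_arc n a b))"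

text \<open>\<open>alternating p q\<close> is the chain
  \<open>p\<^sub>1 < q\<^sub>1 < p\<^sub>2 < q\<^sub>2 < \<dots> < p\<^sub>k < q\<^sub>k\<close>.\<close>

definition alternating :: "nat list \<Rightarrow> nat list \<Rightarrow> bool" where
  "alternating p q \<longleftrightarrow> length p = length q
     \<and> (\<forall>i < length p. p ! i < q ! i)
     \<and> (\<forall>i. Suc i < length p \<longrightarrow> q ! i < p ! Suc i)"

definition interlace :: "nat set \<Rightarrow> nat set \<Rightarrow> bool" where
  "interlace P Q \<longleftrightarrow>
     alternating (sorted_list_of_set P) (sorted_list_of_set Q)
     \<or> alternating (sorted_list_of_set Q) (sorted_list_of_set P)"

text \<open>An undirected simple graph is represented as a finite, loop-free, symmetric digraph
  (\<open>pair_graph\<close>).\<close>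

definition interlacing_graph :: "nat \<Rightarrow> nat \<Rightarrow> nat \<Rightarrow> nat set pair_pre_digraph" where
  "interlacing_graph n k r =
     (let V = {P \<in> polygons n k. stable n r P}
      in \<lparr> pverts = V, parcs = {(P, Q). P \<in> V \<and> Q \<in> V \<and> interlace P Q} \<rparr>)"

text \<open>\<open>\<int>/a\<int>\<close> is represented by \<open>{0..<a}\<close>; as \<open>b \<ge> 1\<close>, the residue classes of
  \<open>b, b + 1, \<dots>, -b\<close> are then the elements of \<open>{b..a - b}\<close>, and there are none if
  \<open>a < 2 * b\<close>.\<close>

definition circular_coloring :: "'a pair_pre_digraph \<Rightarrow> nat \<Rightarrow> nat \<Rightarrow> ('a \<Rightarrow> int) \<Rightarrow> bool" where
  "circular_coloring G a b \<chi> \<longleftrightarrow> 0 < a \<and> 0 < b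
     \<and> \<chi> \<in> pverts G \<rightarrow> {0..<int a}
     \<and> (\<forall>(v, w) \<in> parcs G. (\<chi> v - \<chi> w) mod int a \<in> {int b..int a - int b})"

text \<open>\<open>LEAST\<close> on \<open>rat\<close> is an unspecified value if the minimum does not exist, so an equation
  for it can only be proved by showing that the minimum is attained.\<close>

definition circular_chromatic_number :: "'a pair_pre_digraph \<Rightarrow> rat" where
  "circular_chromatic_number G =
     (LEAST q. \<exists>a b. q = of_nat a / of_nat b \<and> (\<exists>\<chi>. circular_coloring G a b \<chi>))"

lemma pair_graph_interlacing_graph:
  assumes "0 < k"
  shows "pair_graph (interlacing_graph n k r)"
proof -
  have fin: "finite (pverts (interlacing_graph n k r))"
    by (rule finite_subset[of _ "Pow {1..n}"])
      (auto simp: interlacing_graph_def polygons_def Let_def)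
  have irrefl: "\<not> interlace P P" if "P \<in> polygons n k" for P
  proof -
    have "length (sorted_list_of_set P) = k"
      using that by (simp add: polygons_def)
    then show ?thesis
      using assms by (auto simp: interlace_def alternating_def)
  qed
  have sub: "parcs (interlacing_graph n k r)
      \<subseteq> pverts (interlacing_graph n k r) \<times> pverts (interlacing_graph n k r)"
    by (auto simp: interlacing_graph_def Let_def)
  show ?thesis
  proof
    show "finite (pverts (interlacing_graph n k r))" by (rule fin)
    show "finite (parcs (interlacing_graph n k r))"
      using fin sub by (meson finite_SigmaI finite_subset)
    show "symmetric (with_proj (interlacing_graph n k r))"
      by (auto simp: symmetric_def arcs_ends_def arc_to_ends_def interlacing_graph_def
          Let_def interlace_def intro!: symI)
  qed (use sub irrefl in \<open>auto simp: interlacing_graph_def Let_def\<close>)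
qed

end

theory Submission
  imports Defs
begin

text \<open>Colouring a polygon by the sum of its elements modulo \<open>n\<close> is a circular colouring of size
  \<open>n/k\<close>: for interlacing polygons the gaps from \<open>p\<^sub>i\<close> to \<open>q\<^sub>i\<close> and those from \<open>q\<^sub>i\<close> to
  \<open>p\<^sub>i\<^sub>+\<^sub>1\<close> add up to \<open>n\<close>, and each of the two families contributes at least \<open>k\<close>.
  Conversely, the evenly spread polygons \<open>{\<lfloor>(in + t)/k\<rfloor> + 1 | i < k}\<close> for \<open>0 \<le> t < n\<close>
  contain a homomorphic image of the circular clique on \<open>\<int>/n\<int>\<close> (points at cyclic distance at
  least \<open>k\<close> are adjacent). Independent sets of this clique have at most \<open>k\<close> elements, and the
  vertices with colours in a window of \<open>b\<close> consecutive residues are independent, so counting pairs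
  of a vertex and a window around its colour gives \<open>n b \<le> a k\<close>.\<close>

section \<open>The colouring by sums\<close>

text \<open>Each of the \<open>k\<close> strict inequalities \<open>p ! i < q ! i\<close>
  contributes at least 1. For the second bound only \<open>k - 1\<close> inequalities
  \<open>q ! i < p ! Suc i\<close> exist; the unpaired last \<open>q\<close> and first
  \<open>p\<close> differ by at most \<open>n - 1\<close>.\<close>

lemma alternating_sum_bounds:
  assumes alt: "alternating p q" and len: "length p = k" and k: "0 < k"
    and p: "set p \<subseteq> {1..n}" and q: "set q \<subseteq> {1..n}"
  shows "sum_list p + k \<le> sum_list q" and "sum_list q + k \<le> sum_list p + n"
proof -
  obtain m where m: "k = Suc m"
    using k by (cases k) auto
  have len': "length q = k"
    using alt len by (simp add: alternating_def)
  have sums: "sum_list p = (\<Sum>i<k. p ! i)" "sum_list q = (\<Sum>i<k. q ! i)"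
    using len len' by (simp_all add: sum_list_sum_nth atLeast0LessThan)
  have "(\<Sum>i<k. p ! i + 1) \<le> (\<Sum>i<k. q ! i)"
    using alt len by (intro sum_mono) (auto simp: alternating_def Suc_le_eq)
  then show "sum_list p + k \<le> sum_list q"
    by (simp add: sums sum_Suc)
  have "(\<Sum>i<m. q ! i + 1) \<le> (\<Sum>i<m. p ! Suc i)"
    using alt len m by (intro sum_mono) (auto simp: alternating_def Suc_le_eq)
  then have "(\<Sum>i<m. q ! i) + m \<le> (\<Sum>i<m. p ! Suc i)"
    by (simp add: sum_Suc)
  moreover have "q ! m \<le> n"
    using q nth_mem[of m q] len' m by (auto simp del: nth_mem)
  moreover have "1 \<le> p ! 0"
    using p nth_mem[of 0 p] len m by (auto simp del: nth_mem)
  moreover have "sum_list q = (\<Sum>i<m. q ! i) + q ! m"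
    by (simp add: sums m)
  moreover have "sum_list p = p ! 0 + (\<Sum>i<m. p ! Suc i)"
    unfolding sums m by (rule sum.lessThan_Suc_shift)
  ultimately show "sum_list q + k \<le> sum_list p + n"
    using m by linarith
qed

lemma polygon_alternating_sum_bounds:
  assumes "P \<in> polygons n k" "Q \<in> polygons n k" "0 < k"
    and "alternating (sorted_list_of_set P) (sorted_list_of_set Q)"
  shows "\<Sum>P + k \<le> \<Sum>Q" and "\<Sum>Q + k \<le> \<Sum>P + n"
proof -
  have fin: "finite P" "finite Q"
    using assms by (auto simp: polygons_def intro: finite_subset)
  have sum: "sum_list (sorted_list_of_set A) = \<Sum>A" if "finite A" for A :: "nat set"
    using that sum.distinct_set_conv_list[of "sorted_list_of_set A" "\<lambda>x. x"] by simp
  show "\<Sum>P + k \<le> \<Sum>Q" "\<Sum>Q + k \<le> \<Sum>P + n"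
    using alternating_sum_bounds[OF assms(4), of k n] assms fin
    by (auto simp: sum polygons_def)
qed

lemma circular_coloring_sum:
  assumes k: "0 < k" and n: "2 * k \<le> n"
  shows "circular_coloring (interlacing_graph n k r) n k (\<lambda>P. int (\<Sum>P) mod int n)"
proof -
  \<comment> \<open>Interlacing does not say which sum is larger, so both signs are treated; the
    negative difference is shifted by \<open>n\<close>.\<close>
  have diff: "(x - y) mod int n \<in> {int k..int n - int k} \<and>
      (y - x) mod int n \<in> {int k..int n - int k}"
    if "y + int k \<le> x" "x + int k \<le> y + int n" for x y :: int
  proof -
    have "(x - y) mod int n = x - y"
      using that k by (intro mod_pos_pos_trivial) auto
    moreover have "(y - x) mod int n = (y - x + int n) mod int n"
      by simp
    moreover have "(y - x + int n) mod int n = y - x + int n"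
      using that k by (intro mod_pos_pos_trivial) auto
    ultimately show ?thesis
      using that by auto
  qed
  have "(int (\<Sum>P) mod int n - int (\<Sum>Q) mod int n) mod int n \<in> {int k..int n - int k}"
    if "P \<in> polygons n k" "Q \<in> polygons n k" "interlace P Q" for P Q
    using that(3) unfolding interlace_def mod_diff_eq
  proof
    assume "alternating (sorted_list_of_set P) (sorted_list_of_set Q)"
    from polygon_alternating_sum_bounds[OF that(1,2) k this]
    show "(int (\<Sum>P) - int (\<Sum>Q)) mod int n \<in> {int k..int n - int k}"
      by (intro diff[THEN conjunct2]) linarith+
  next
    assume "alternating (sorted_list_of_set Q) (sorted_list_of_set P)"
    from polygon_alternating_sum_bounds[OF that(2,1) k this]
    show "(int (\<Sum>P) - int (\<Sum>Q)) mod int n \<in> {int k..int n - int k}"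
      by (intro diff[THEN conjunct1]) linarith+
  qed
  then show ?thesis
    using k n unfolding circular_coloring_def interlacing_graph_def Let_def by auto
qed

section \<open>Evenly spread polygons\<close>

text \<open>Replacing \<open>t\<close> by \<open>t + n\<close> has the effect of replacing
  \<open>i\<close> by \<open>i + 1\<close>, so \<open>t\<close> acts as a fine rotation parameter.
  The final \<open>+ 1\<close> moves the values into \<open>{1..n}\<close>.\<close>

definition even_vertex :: "nat \<Rightarrow> nat \<Rightarrow> nat \<Rightarrow> nat \<Rightarrow> nat" where
  "even_vertex n k t i = (i * n + t) div k + 1"

definition even_polygon :: "nat \<Rightarrow> nat \<Rightarrow> nat \<Rightarrow> nat set" where
  "even_polygon n k t = even_vertex n k t ` {..<k}"

lemma div_add_le_div:
  fixes x y c k :: nat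
  assumes "0 < k" "x + c * k \<le> y"
  shows "x div k + c \<le> y div k"
  using div_le_mono[OF assms(2), of k] assms(1) by simp

lemma even_vertex_gap:
  assumes "0 < k" "r * k \<le> n" "i < j"
  shows "even_vertex n k t i + r \<le> even_vertex n k t j"
proof -
  have "Suc i * n \<le> j * n"
    using assms(3) by (intro mult_le_mono1) simp
  then have "i * n + t + r * k \<le> j * n + t"
    using assms(2) by simp
  from div_add_le_div[OF assms(1) this] show ?thesis
    by (simp add: even_vertex_def)
qed

text \<open>This is the gap across the point where the circle closes: adding \<open>n\<close> to a
  vertex adds \<open>n * k\<close> to its numerator, and \<open>Suc j * n\<close> is at most
  \<open>k * n\<close>.\<close>

lemma even_vertex_wrap_gap:
  assumes "0 < k" "r * k \<le> n" "j < k"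
  shows "even_vertex n k t j + r \<le> even_vertex n k t i + n"
proof -
  have "Suc j * n \<le> k * n"
    using assms(3) by (intro mult_le_mono1) simp
  then have "j * n + t + r * k \<le> i * n + t + n * k"
    using assms(2) by (simp add: mult.commute)
  from div_add_le_div[OF assms(1) this] show ?thesis
    using assms(1) by (simp add: even_vertex_def)
qed

lemma even_vertex_less:
  assumes "0 < k" "k \<le> n" "i < j"
  shows "even_vertex n k t i < even_vertex n k t j"
  using even_vertex_gap[of k 1 n i j t] assms by simp

lemma inj_on_even_vertex:
  assumes "0 < k" "k \<le> n"
  shows "inj_on (even_vertex n k t) A"
  by (rule inj_onI) (metis assms even_vertex_less less_irrefl linorder_neqE_nat)

lemma even_polygon_in_polygons:
  assumes k: "0 < k" "k \<le> n" and t: "t < n"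
  shows "even_polygon n k t \<in> polygons n k"
proof -
  have "even_vertex n k t i \<le> n" if "i < k" for i
  proof -
    have "Suc i * n \<le> k * n"
      using that by (intro mult_le_mono1) simp
    then have "i * n + t < n * k"
      using t by (simp add: mult.commute)
    then show ?thesis
      using k by (simp add: even_vertex_def less_mult_imp_div_less Suc_le_eq)
  qed
  then have "even_polygon n k t \<subseteq> {1..n}"
    by (auto simp: even_polygon_def even_vertex_def)
  then show ?thesis
    using inj_on_even_vertex[OF k] by (simp add: polygons_def even_polygon_def card_image)
qed

lemma stable_even_polygon:
  assumes k: "0 < k" "k \<le> n" and r: "0 < r" "r * k \<le> n" and t: "t < n"
  shows "stable n r (even_polygon n k t)"
proof -
  let ?f = "even_vertex n k t"
  have "r - 1 \<le> card (open_arc n (?f i) (?f j))"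
    if "i < k" "j < k" "?f i \<noteq> ?f j" for i j
  proof (cases "i < j")
    case True
    then show ?thesis
      using even_vertex_gap[OF k(1) r(2) True, of t] r(1) by (simp add: open_arc_def)
  next
    case False
    with that have "j < i"
      by (metis linorder_neqE_nat)
    from even_vertex_less[OF k this] have less: "?f j < ?f i" .
    have "?f i \<in> {1..n}"
      using even_polygon_in_polygons[OF k t] that(1)
      by (auto simp: polygons_def even_polygon_def)
    moreover have "1 \<le> ?f j"
      by (simp add: even_vertex_def)
    moreover have "card (open_arc n (?f i) (?f j)) = (n - ?f i) + (?f j - 1)"
      using less by (simp add: open_arc_def card_Un_disjoint disjoint_iff)
    ultimately show ?thesis
      using even_vertex_wrap_gap[OF k(1) r(2) that(1), of t j] by auto
  qed
  then show ?thesis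
    by (auto simp: stable_def even_polygon_def)
qed

lemma sorted_list_of_even_polygon:
  assumes "0 < k" "k \<le> n"
  shows "sorted_list_of_set (even_polygon n k t) = map (even_vertex n k t) [0..<k]"
proof -
  have "sorted_wrt (<) (map (even_vertex n k t) [0..<k])"
    using even_vertex_less[OF assms]
    by (auto simp: sorted_wrt_map intro: sorted_wrt_mono_rel[OF _ sorted_wrt_upt])
  moreover have "set (map (even_vertex n k t) [0..<k]) = even_polygon n k t"
    by (auto simp: even_polygon_def)
  ultimately show ?thesis
    by (metis sorted_list_of_set.idem_if_sorted_distinct strict_sorted_iff)
qed

text \<open>Each hypothesis makes consecutive numerators in the chain differ by at least
  \<open>k\<close>, which forces the quotients to differ by at least 1.\<close>

lemma interlace_even_polygon:
  assumes k: "0 < k" "k \<le> n" and st: "s + k \<le> t" "t + k \<le> s + n"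
  shows "interlace (even_polygon n k s) (even_polygon n k t)"
proof -
  have "even_vertex n k s i < even_vertex n k t i" for i
    using div_add_le_div[OF k(1), of "i * n + s" 1 "i * n + t"] st
    by (simp add: even_vertex_def)
  moreover have "even_vertex n k t i < even_vertex n k s (Suc i)" for i
    using div_add_le_div[OF k(1), of "i * n + t" 1 "Suc i * n + s"] st
    by (simp add: even_vertex_def)
  ultimately show ?thesis
    by (simp add: interlace_def alternating_def sorted_list_of_even_polygon[OF k])
qed

section \<open>The circular clique\<close>

lemma card_circular_clique_independent:
  fixes I :: "nat set"
  assumes n: "2 * k \<le> n" and k: "0 < k" and I: "I \<subseteq> {..<n}"
    and indep: "\<And>s t. s \<in> I \<Longrightarrow> t \<in> I \<Longrightarrow> s + k \<le> t \<Longrightarrow> t + k \<le> s + n \<Longrightarrow> False"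
  shows "card I \<le> k"
proof (cases "I = {}")
  case False
  have fin: "finite I"
    using I by (rule finite_subset) simp
  define x where "x = Min I"
  have x: "x \<in> I" "\<And>y. y \<in> I \<Longrightarrow> x \<le> y"
    using False fin by (auto simp: x_def)
  \<comment> \<open>Katona's pairing: of two points at distance \<open>n - k\<close>, at most one lies in \<open>I\<close>.\<close>
  define g where "g y = (if y < x + k then y - x else y + k - x - n)" for y
  \<comment> \<open>A point of \<open>I\<close> not within \<open>k\<close> after \<open>x\<close>
    lies within \<open>k\<close> before it cyclically, so the subtraction in \<open>g\<close> does
    not truncate.\<close>
  have far: "x + n < y + k" if "y \<in> I" "\<not> y < x + k" for y
    using indep[OF x(1) that(1)] that(2) by (meson not_le)
  have "g ` I \<subseteq> {..<k}"
  proof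
    fix z assume "z \<in> g ` I"
    then obtain y where y: "y \<in> I" "z = g y"
      by blast
    then show "z \<in> {..<k}"
      using I x(2)[OF y(1)] k by (auto simp: g_def)
  qed
  moreover have "inj_on g I"
  proof (rule inj_onI)
    fix y z assume yz: "y \<in> I" "z \<in> I" and eq: "g y = g z"
    \<comment> \<open>Equality would give \<open>w = v + (n - k)\<close> with
      \<open>n - k \<ge> k\<close>, a forbidden pair.\<close>
    have "v + n \<noteq> w + k" if "v \<in> I" "w \<in> I" for v w
      using indep[OF that] n by fastforce
    then have "y + n \<noteq> z + k" "z + n \<noteq> y + k"
      using yz by blast+
    then show "y = z"
      using eq far[OF yz(1)] far[OF yz(2)] x(2)[OF yz(1)] x(2)[OF yz(2)]
      by (auto simp: g_def split: if_splits)
  qed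
  ultimately show ?thesis
    using card_inj_on_le[of g I "{..<k}"] by simp
qed simp

lemma circular_clique_ratio:
  fixes c :: "nat \<Rightarrow> int"
  assumes k: "0 < k" and n: "2 * k \<le> n" and a: "0 < a"
    and col: "\<And>s t. s < n \<Longrightarrow> t < n \<Longrightarrow> s + k \<le> t \<Longrightarrow> t + k \<le> s + n \<Longrightarrow>
      (c s - c t) mod int a \<in> {int b..int a - int b}"
  shows "n * b \<le> a * k"
proof -
  \<comment> \<open>The vertices \<open>0\<close> and \<open>k\<close> are adjacent, so the set of
    allowed differences is nonempty.\<close>
  have ba: "b \<le> a"
    using col[of 0 k] n k by auto
  define W where "W j = {t \<in> {..<n}. (c t - j) mod int a < int b}" for j :: int
  have W: "card (W j) \<le> k" for j
  proof (rule card_circular_clique_independent[OF n k])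
    fix s t assume st: "s \<in> W j" "t \<in> W j" "s + k \<le> t" "t + k \<le> s + n"
    \<comment> \<open>Two offsets in the same window differ by less than \<open>b\<close> in
      absolute value, hence not by an allowed residue.\<close>
    define u v where "u = (c s - j) mod int a" and "v = (c t - j) mod int a"
    have uv: "0 \<le> u" "u < int b" "0 \<le> v" "v < int b"
      using st a by (auto simp: W_def u_def v_def)
    have "(u - v) mod int a = (c s - c t) mod int a"
      unfolding u_def v_def by (simp add: mod_diff_eq)
    then have bounds: "(u - v) mod int a \<in> {int b..int a - int b}"
      using col[of s t] st by (auto simp: W_def)
    show False
    proof (cases "v \<le> u")
      case True
      then have "(u - v) mod int a = u - v"
        using uv ba by (intro mod_pos_pos_trivial) auto
      then show False
        using bounds uv by auto
    next
      case False
      have "(u - v) mod int a = (u - v + int a) mod int a"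
        by simp
      also have "\<dots> = u - v + int a"
        using False uv ba by (intro mod_pos_pos_trivial) auto
      finally show False
        using bounds uv by auto
    qed
  qed (auto simp: W_def)
  have windows: "b \<le> card {j \<in> {0..<int a}. (c t - j) mod int a < int b}" for t
  proof -
    let ?h = "\<lambda>i. (c t - i) mod int a"
    \<comment> \<open>Reflection exchanges the offset of the colour with the start of the window, so
      the \<open>b\<close> offsets yield \<open>b\<close> distinct windows.\<close>
    have inv: "?h (?h i) = i" if "i \<in> {0..<int b}" for i
      using that ba by (simp add: mod_diff_right_eq)
    have "?h ` {0..<int b} \<subseteq> {j \<in> {0..<int a}. (c t - j) mod int a < int b}"
      using inv a by auto
    moreover have "inj_on ?h {0..<int b}"
      by (rule inj_on_inverseI) (rule inv)
    ultimately have "card {0..<int b} \<le> card {j \<in> {0..<int a}. (c t - j) mod int a < int b}"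
      by (intro card_inj_on_le[of ?h] finite_Collect_conjI disjI1) simp_all
    then show ?thesis
      by simp
  qed
  have "n * b = (\<Sum>t<n. b)"
    by simp
  also have "\<dots> \<le> (\<Sum>t<n. card {j \<in> {0..<int a}. (c t - j) mod int a < int b})"
    by (intro sum_mono windows)
  also have "\<dots> = (\<Sum>j\<in>{0..<int a}. card (W j))"
    unfolding W_def by (rule sum_multicount_gen) auto
  also have "\<dots> \<le> (\<Sum>j\<in>{0..<int a}. k)"
    by (intro sum_mono W)
  finally show ?thesis
    by simp
qed

text \<open>The map \<open>t \<mapsto> even_polygon n k t\<close> is a homomorphism from the
  circular clique, so composing with it pulls the colouring back.\<close>

lemma circular_coloring_interlacing_graph_ratio:
  assumes k: "0 < k" and r: "2 \<le> r" "r * k \<le> n"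
    and col: "circular_coloring (interlacing_graph n k r) a b \<chi>"
  shows "n * b \<le> a * k"
proof (rule circular_clique_ratio[OF k, where c = "\<lambda>t. \<chi> (even_polygon n k t)"])
  show n: "2 * k \<le> n"
    using mult_le_mono1[OF r(1), of k] r(2) by (rule order_trans)
  show "0 < a"
    using col by (simp add: circular_coloring_def)
  fix s t assume st: "s < n" "t < n" "s + k \<le> t" "t + k \<le> s + n"
  have kn: "k \<le> n"
    using n by simp
  have "(even_polygon n k s, even_polygon n k t) \<in> parcs (interlacing_graph n k r)"
    using st k kn r
    by (simp add: interlacing_graph_def even_polygon_in_polygons stable_even_polygon
        interlace_even_polygon)
  then show "(\<chi> (even_polygon n k s) - \<chi> (even_polygon n k t)) mod int a
      \<in> {int b..int a - int b}"
    using col unfolding circular_coloring_def by fast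
qed

theorem theorem1:
  fixes n k r :: nat
  assumes "0 < n" and "0 < k" and "0 < r"
    and "2 \<le> r" and "r * k \<le> n"
  shows "circular_chromatic_number (interlacing_graph n k r) = of_nat n / of_nat k"
  unfolding circular_chromatic_number_def
proof (rule Least_equality)
  have "2 * k \<le> n"
    using mult_le_mono1[OF assms(4), of k] assms(5) by (rule order_trans)
  then show "\<exists>a b. (of_nat n / of_nat k :: rat) = of_nat a / of_nat b \<and>
      (\<exists>\<chi>. circular_coloring (interlacing_graph n k r) a b \<chi>)"
    using circular_coloring_sum[OF assms(2)] by blast
next
  fix q :: rat
  assume "\<exists>a b. q = of_nat a / of_nat b \<and>
      (\<exists>\<chi>. circular_coloring (interlacing_graph n k r) a b \<chi>)"
  then obtain a b \<chi> where q: "q = of_nat a / of_nat b"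
    and col: "circular_coloring (interlacing_graph n k r) a b \<chi>"
    by blast
  have "(of_nat (n * b) :: rat) \<le> of_nat (a * k)"
    using circular_coloring_interlacing_graph_ratio[OF assms(2,4,5) col]
    by (simp only: of_nat_le_iff)
  moreover have "0 < b"
    using col by (simp add: circular_coloring_def)
  ultimately show "of_nat n / of_nat k \<le> q"
    using assms(2) by (simp add: q divide_simps)
qed

end
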